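(* Let $k,d$ be integers with $2\le k\le d-1$ and let $P$ and $Q$ be two convex polytopes in ${\mathbb E}^d$ such that for every $k$-dimensional linear subspace $H$ of ${\mathbb E}^d$ the orthogonal projections $P|H$ and $Q|H$ of $P$ and $Q$ onto $H$ are congruent. Then there exists $b\in{\mathbb E}^d$ such that $P=Q+b$ or $P=-Q+b$.
   Context: ${\mathbb E}^d$ is $d$-dimensional Euclidean space. A convex polytope in ${\mathbb E}^d$ is a convex body (compact convex set with non-empty interior in ${\mathbb E}^d$) that is the convex hull of finitely many points. For a $k$-dimensional subspace $H$, $P|H$ denotes the orthogonal projection of $P$ onto $H$. The projections $P|H$ and $Q|H$ are called congruent if there exists an orthogonal transformation $\varphi\in O(k,H)$ of $H$ (reflections allowed; $\varphi$ may depend on $H$) such that $\varphi(P|H)$ is a translate of $Q|H$. $-Q=\{-x: x\in Q\}$. *)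

theory Defs
  imports "HOL-Analysis.Analysis"
begin

definition convex_polytope :: "'a::euclidean_space set \<Rightarrow> bool"
  where "convex_polytope P \<longleftrightarrow> polytope P \<and> interior P \<noteq> {}"

text \<open>Meaningful only if \<open>H\<close> is a subspace; see \<open>orthogonal_projection_works\<close>.\<close>

definition orthogonal_projection :: "'a::euclidean_space set \<Rightarrow> 'a \<Rightarrow> 'a"
  where "orthogonal_projection H x = (THE y. y \<in> H \<and> x - y \<in> orthogonal_comp H)"

lemma orthogonal_projection_works:
  fixes H :: "'a::euclidean_space set"
  assumes "subspace H"
  shows "orthogonal_projection H x \<in> H \<and> x - orthogonal_projection H x \<in> orthogonal_comp H"
  unfolding orthogonal_projection_def
proof (rule theI')
  have "span H = H" using assms by (simp add: span_eq_iff)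
  then obtain y z where y: "y \<in> H" and z: "\<And>w. w \<in> H \<Longrightarrow> orthogonal z w" and x: "x = y + z"
    using orthogonal_subspace_decomp_exists [of H x] by metis
  show "\<exists>!y. y \<in> H \<and> x - y \<in> orthogonal_comp H"
  proof
    show "y \<in> H \<and> x - y \<in> orthogonal_comp H"
      using x y z by (auto simp: orthogonal_comp_def orthogonal_commute)
  next
    fix y'
    assume y': "y' \<in> H \<and> x - y' \<in> orthogonal_comp H"
    have "y' - y \<in> H" using assms y y' by (simp add: subspace_diff)
    then have "(y' - y) \<bullet> (x - y') = 0" "(y' - y) \<bullet> (x - y) = 0"
      using y' z [of "y' - y"] x by (auto simp: orthogonal_comp_def orthogonal_def inner_commute)
    then have "(y' - y) \<bullet> (y' - y) = 0" by (simp add: inner_diff_right)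
    then show "y' = y" by simp
  qed
qed

text \<open>The orthogonal group of the Euclidean space \<open>H\<close>: only the values of \<open>\<phi>\<close> on \<open>H\<close> matter.\<close>

definition orthogonal_transformation_on :: "'a::euclidean_space set \<Rightarrow> ('a \<Rightarrow> 'a) \<Rightarrow> bool"
  where "orthogonal_transformation_on H \<phi> \<longleftrightarrow>
    \<phi> ` H = H \<and>
    (\<forall>x\<in>H. \<forall>y\<in>H. \<phi> (x + y) = \<phi> x + \<phi> y) \<and>
    (\<forall>c. \<forall>x\<in>H. \<phi> (c *\<^sub>R x) = c *\<^sub>R \<phi> x) \<and>
    (\<forall>x\<in>H. \<forall>y\<in>H. \<phi> x \<bullet> \<phi> y = x \<bullet> y)"

lemma orthogonal_transformation_on_UNIV:
  "orthogonal_transformation_on UNIV \<phi> \<longleftrightarrow> orthogonal_transformation \<phi>"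
  using orthogonal_transformation_surj [of \<phi>]
  by (auto simp: orthogonal_transformation_on_def orthogonal_transformation_def linear_iff)

definition congruent_in :: "'a::euclidean_space set \<Rightarrow> 'a set \<Rightarrow> 'a set \<Rightarrow> bool"
  where "congruent_in H A B \<longleftrightarrow>
    (\<exists>\<phi>. orthogonal_transformation_on H \<phi> \<and> (\<exists>t\<in>H. \<phi> ` A = (+) t ` B))"

end

theory Submission
  imports Defs
begin

text \<open>For a generic subspace \<open>H\<close>, the projection \<open>\<pi>\<close> onto \<open>H\<close> satisfies \<open>norm (\<pi> x) \<noteq> norm (\<pi> y)\<close> for
  all differences \<open>x\<close> of vertices of \<open>P\<close> and \<open>y\<close> of vertices of \<open>Q\<close> with \<open>x \<noteq> y\<close> and \<open>x \<noteq> - y\<close>.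
  The congruence of the projections matches their vertices isometrically, so it lifts to a matching
  of vertices of \<open>P\<close> and \<open>Q\<close> that preserves differences up to sign. The sign is the same for all
  pairs, hence the projection of \<open>Q\<close> is a translate of that of \<open>P\<close> or of \<open>- P\<close>.
  In terms of support functions, on a generic \<open>H\<close> one of \<open>f u = h\<^sub>P u - h\<^sub>Q u\<close> and
  \<open>g u = h\<^sub>P u - h\<^sub>Q (- u)\<close> is linear. As nonlinearity is an open condition, this holds on every
  \<open>H\<close>, and then \<open>f\<close> or \<open>g\<close> is linear on the whole space.\<close>

section \<open>Orthogonal projections\<close>

lemma orthogonal_projection_in:
  "subspace H \<Longrightarrow> orthogonal_projection H x \<in> H"
  using orthogonal_projection_works by blast

lemma orthogonal_projection_residual:
  assumes "subspace H" "y \<in> H"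
  shows "(x - orthogonal_projection H x) \<bullet> y = 0"
  using orthogonal_projection_works[OF assms(1), of x] assms(2)
  by (auto simp: orthogonal_comp_def orthogonal_def inner_commute)

lemma orthogonal_projection_unique:
  assumes "subspace H" "y \<in> H" "\<And>z. z \<in> H \<Longrightarrow> (x - y) \<bullet> z = 0"
  shows "orthogonal_projection H x = y"
proof -
  let ?p = "orthogonal_projection H x"
  have d: "?p - y \<in> H"
    using assms orthogonal_projection_in subspace_diff by blast
  have "(?p - y) \<bullet> (?p - y) = (x - y) \<bullet> (?p - y) - (x - ?p) \<bullet> (?p - y)"
    by (simp add: inner_diff_left)
  then show ?thesis
    using assms(3)[OF d] orthogonal_projection_residual[OF assms(1) d, of x] by simp
qed

lemma orthogonal_projection_ident:
  "subspace H \<Longrightarrow> x \<in> H \<Longrightarrow> orthogonal_projection H x = x"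
  by (rule orthogonal_projection_unique) auto

lemma linear_orthogonal_projection:
  assumes "subspace H"
  shows "linear (orthogonal_projection H)"
proof
  fix x y and c :: real
  show "orthogonal_projection H (x + y) = orthogonal_projection H x + orthogonal_projection H y"
  proof (rule orthogonal_projection_unique[OF assms])
    fix z assume "z \<in> H"
    then show "(x + y - (orthogonal_projection H x + orthogonal_projection H y)) \<bullet> z = 0"
      using orthogonal_projection_residual[OF assms, of z x]
        orthogonal_projection_residual[OF assms, of z y]
      by (simp add: inner_diff_left inner_add_left)
  qed (simp add: assms orthogonal_projection_in subspace_add)
  show "orthogonal_projection H (c *\<^sub>R x) = c *\<^sub>R orthogonal_projection H x"
  proof (rule orthogonal_projection_unique[OF assms])
    fix z assume "z \<in> H"
    then show "(c *\<^sub>R x - c *\<^sub>R orthogonal_projection H x) \<bullet> z = 0"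
      using orthogonal_projection_residual[OF assms, of z x]
      by (simp flip: scaleR_diff_right)
  qed (simp add: assms orthogonal_projection_in subspace_scale)
qed

lemma inner_orthogonal_projection:
  assumes "subspace H" "u \<in> H"
  shows "u \<bullet> orthogonal_projection H x = u \<bullet> x"
  using orthogonal_projection_residual[OF assms, of x]
  by (simp add: inner_diff_left inner_diff_right inner_commute)

text \<open>Difference of squares. It turns equality of projected lengths into the vanishing of
  \<open>s \<bullet> orthogonal_projection H t\<close>, the form in which genericity is perturbed
  below.\<close>

lemma inner_orthogonal_projection_self:
  assumes "subspace H"
  shows "(x + y) \<bullet> orthogonal_projection H (x - y) =
    (norm (orthogonal_projection H x))\<^sup>2 - (norm (orthogonal_projection H y))\<^sup>2"
proof -
  let ?p = "orthogonal_projection H"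
  have "(x + y) \<bullet> ?p (x - y) = ?p (x + y) \<bullet> ?p (x - y)"
    using inner_orthogonal_projection[OF assms orthogonal_projection_in[OF assms]]
    by (metis inner_commute)
  also have "\<dots> = (?p x + ?p y) \<bullet> (?p x - ?p y)"
    using linear_orthogonal_projection[OF assms] by (simp add: linear_add linear_diff)
  also have "\<dots> = (norm (?p x))\<^sup>2 - (norm (?p y))\<^sup>2"
    by (simp add: power2_norm_eq_inner inner_add_left inner_diff_right inner_commute algebra_simps)
  finally show ?thesis .
qed

section \<open>Generic subspaces\<close>

text \<open>Two proper hyperplanes of \<open>S\<close> cannot cover it. If \<open>s\<close> and
  \<open>t\<close> are nonzero, the explicit witness is \<open>s + t\<close> when they are
  orthogonal and \<open>s\<close> otherwise, normalized.\<close>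

lemma subspace_unit_vector_avoiding:
  fixes S :: "'a::euclidean_space set"
  assumes "subspace S" "S \<noteq> {0}" "s \<in> S" "t \<in> S"
  obtains e where "e \<in> S" "norm e = 1" "s \<noteq> 0 \<Longrightarrow> s \<bullet> e \<noteq> 0" "t \<noteq> 0 \<Longrightarrow> t \<bullet> e \<noteq> 0"
proof -
  obtain z where z: "z \<in> S" "z \<noteq> 0"
    using assms subspace_0 by blast
  have "\<exists>e\<in>S. e \<noteq> 0 \<and> (s \<noteq> 0 \<longrightarrow> s \<bullet> e \<noteq> 0) \<and> (t \<noteq> 0 \<longrightarrow> t \<bullet> e \<noteq> 0)"
  proof (cases "s = 0 \<or> t = 0")
    case True
    then show ?thesis
      using assms(3,4) z by (metis inner_eq_zero_iff)
  next
    case False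
    show ?thesis
    proof (cases "s \<bullet> t = 0")
      case True
      have "s + t \<in> S"
        using assms subspace_add by blast
      moreover have "s \<bullet> (s + t) \<noteq> 0" "t \<bullet> (s + t) \<noteq> 0"
        using True False by (simp_all add: inner_add_right inner_commute)
      ultimately show ?thesis
        by (metis inner_zero_right)
    next
      case False
      then show ?thesis
        using assms(3) by (intro bexI[of _ s]) (auto simp: inner_commute)
    qed
  qed
  then obtain e where "e \<in> S" "e \<noteq> 0" "s \<noteq> 0 \<longrightarrow> s \<bullet> e \<noteq> 0" "t \<noteq> 0 \<longrightarrow> t \<bullet> e \<noteq> 0"
    by blast
  then show ?thesis
    using assms(1) by (intro that[of "e /\<^sub>R norm e"]) (auto simp: subspace_scale)
qed

text \<open>\<open>G\<close> arises from \<open>H\<close> by exchanging \<open>e\<close> for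
  \<open>e'\<close> and keeping the orthogonal complement of \<open>e\<close> in \<open>H\<close>.
  By \<open>perp\<close>, \<open>e'\<close> is orthogonal to the part kept, so only one rank-one
  term of the projection changes.\<close>

lemma rotated_subspace:
  fixes H :: "'a::euclidean_space set"
  assumes H: "subspace H" and e: "e \<in> H" "norm e = 1" and e': "norm e' = 1"
    and perp: "\<And>z. z \<in> H \<Longrightarrow> z \<bullet> e = 0 \<Longrightarrow> z \<bullet> e' = 0"
  obtains G where "subspace G" "dim G = dim H"
    "\<And>x. orthogonal_projection G x = orthogonal_projection H x - (x \<bullet> e) *\<^sub>R e + (x \<bullet> e') *\<^sub>R e'"
proof -
  let ?p = "orthogonal_projection H"
  define R where "R x = x - (x \<bullet> e) *\<^sub>R e + (x \<bullet> e) *\<^sub>R e'" for x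
  have R: "linear R"
    unfolding R_def by (intro linearI) (auto simp: algebra_simps)
  have ee: "e \<bullet> e = 1" and ee': "e' \<bullet> e' = 1"
    using e e' by (simp_all add: norm_eq_1)
  have rest: "y - (y \<bullet> e) *\<^sub>R e \<in> H" "(y - (y \<bullet> e) *\<^sub>R e) \<bullet> e = 0"
     "(y - (y \<bullet> e) *\<^sub>R e) \<bullet> e' = 0" if "y \<in> H" for y
  proof -
    show "y - (y \<bullet> e) *\<^sub>R e \<in> H"
      using H e that by (simp add: subspace_diff subspace_scale)
    moreover show "(y - (y \<bullet> e) *\<^sub>R e) \<bullet> e = 0"
      using ee by (simp add: inner_diff_left)
    ultimately show "(y - (y \<bullet> e) *\<^sub>R e) \<bullet> e' = 0"
      by (rule perp)
  qed
  have "y = 0" if "y \<in> H" "R y = 0" for y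
  proof -
    let ?y = "y - (y \<bullet> e) *\<^sub>R e"
    have "R y \<bullet> e' = y \<bullet> e"
      using rest(3)[OF that(1)] ee' by (simp add: R_def inner_add_left)
    then have "y \<bullet> e = 0"
      using that by simp
    then show ?thesis
      using that by (simp add: R_def)
  qed
  then have "inj_on R H"
    using linear_inj_on_iff_eq_0[OF R H] by blast
  then have dim: "dim (R ` H) = dim H"
    using R H by (intro dim_image_eq) (simp_all add: span_eq_iff[THEN iffD2])
  have G: "subspace (R ` H)"
    using R H by (rule linear_subspace_image)
  have "orthogonal_projection (R ` H) x = ?p x - (x \<bullet> e) *\<^sub>R e + (x \<bullet> e') *\<^sub>R e'" (is "_ = ?q") for x
  proof (rule orthogonal_projection_unique[OF G])
    have pe: "?p x \<bullet> e = x \<bullet> e"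
      using inner_orthogonal_projection[OF H e(1), of x] by (simp add: inner_commute)
    \<comment> \<open>The preimage of \<open>?q\<close> under \<open>R\<close>: the
      \<open>e\<close>-coordinate of \<open>?p x\<close> is replaced by the
      \<open>e'\<close>-coordinate of \<open>x\<close>.\<close>
    let ?z = "?p x - (x \<bullet> e) *\<^sub>R e + (x \<bullet> e') *\<^sub>R e"
    have "?z \<bullet> e = x \<bullet> e'"
      using pe ee by (simp add: inner_add_left inner_diff_left)
    then have "R ?z = ?q"
      by (simp add: R_def)
    moreover have "?z \<in> H"
      using H e by (simp add: subspace_diff subspace_add subspace_scale orthogonal_projection_in)
    ultimately show "?q \<in> R ` H"
      by (metis imageI)
    fix y assume "y \<in> R ` H"
    then obtain v where v: "v \<in> H" "y = R v"
      by blast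
    let ?v = "v - (v \<bullet> e) *\<^sub>R e"
    have "(?p x - (x \<bullet> e) *\<^sub>R e) \<bullet> e' = 0"
      using rest(3)[OF orthogonal_projection_in[OF H], of x] pe by simp
    then have 1: "(x - ?q) \<bullet> e' = 0"
      using ee' by (simp add: inner_diff_left inner_add_left)
    have "(x - ?p x) \<bullet> ?v = 0"
      using orthogonal_projection_residual[OF H rest(1)[OF v(1)]] .
    moreover have "e \<bullet> ?v = 0" "e' \<bullet> ?v = 0"
      using rest(2,3)[OF v(1)] by (simp_all add: inner_commute)
    moreover have "(x - ?q) \<bullet> ?v =
      (x - ?p x) \<bullet> ?v + (x \<bullet> e) * (e \<bullet> ?v) - (x \<bullet> e') * (e' \<bullet> ?v)"
      by (simp only: inner_diff_left inner_add_left inner_scaleR_left)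
    ultimately have 2: "(x - ?q) \<bullet> ?v = 0"
      by simp
    have "(x - ?q) \<bullet> y = (x - ?q) \<bullet> ?v + (v \<bullet> e) * ((x - ?q) \<bullet> e')"
      unfolding v(2) R_def by (simp only: inner_add_right inner_scaleR_right)
    then show "(x - ?q) \<bullet> y = 0"
      using 1 2 by simp
  qed
  then show ?thesis
    using that[OF G dim] by blast
qed

text \<open>A polynomial in \<tau> of degree at most 2 that vanishes at 0, \<eta> and -\<eta> has
  only zero coefficients, and here these cannot all be zero.\<close>

lemma quadratic_avoid:
  fixes K a b c d \<eta> :: real
  assumes "a \<noteq> 0 \<or> b \<noteq> 0" "c \<noteq> 0 \<or> d \<noteq> 0" "\<eta> > 0"
  obtains \<tau> where "\<bar>\<tau>\<bar> \<le> \<eta>" "K * (1 + \<tau>\<^sup>2) + (a + \<tau> * b) * (c + \<tau> * d) \<noteq> 0"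
proof -
  define F where "F \<tau> = K * (1 + \<tau>\<^sup>2) + (a + \<tau> * b) * (c + \<tau> * d)" for \<tau>
  have "\<exists>\<tau>. \<bar>\<tau>\<bar> \<le> \<eta> \<and> F \<tau> \<noteq> 0"
  proof (rule ccontr)
    assume "\<not> ?thesis"
    then have "F 0 = 0" "F \<eta> = 0" "F (-\<eta>) = 0"
      using assms(3) by auto
    then have 0: "K + a * c = 0" and p: "K * (1 + \<eta>\<^sup>2) + (a + \<eta> * b) * (c + \<eta> * d) = 0"
      and m: "K * (1 + \<eta>\<^sup>2) + (a - \<eta> * b) * (c - \<eta> * d) = 0"
      by (auto simp: F_def)
    have "2 * \<eta> * (a * d + b * c) = 0"
      using p m by (simp add: algebra_simps)
    then have 1: "a * d + b * c = 0"
      using assms(3) by simp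
    have "\<eta>\<^sup>2 * (K + b * d) + (K + a * c) + \<eta> * (a * d + b * c) = 0"
      using p by (simp add: algebra_simps power2_eq_square)
    then have 2: "K + b * d = 0"
      using assms(3) 0 1 by simp
    \<comment> \<open>Multiplicativity of the complex modulus for \<open>a + i b\<close> and
      \<open>c + i d\<close>: the vanishing coefficients say that their product is 0.\<close>
    have "(a\<^sup>2 + b\<^sup>2) * (c\<^sup>2 + d\<^sup>2) = (a * c - b * d)\<^sup>2 + (a * d + b * c)\<^sup>2"
      by (simp add: algebra_simps power2_eq_square)
    also have "\<dots> = 0"
      using 0 1 2 by (simp add: algebra_simps)
    finally show False
      using assms by (auto simp: sum_power2_eq_zero_iff)
  qed
  then show ?thesis
    using that F_def by auto
qed

text \<open>Rotating a unit vector \<open>e \<in> H\<close> towards a unit vector \<open>w\<close> orthogonal to \<open>H\<close> changes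
  \<open>s \<bullet> orthogonal_projection H t\<close> by a nonconstant function of the angle, unless
  \<open>s\<close> or \<open>t\<close> is orthogonal to both \<open>e\<close> and \<open>w\<close>.\<close>

lemma perturb_subspace_avoiding:
  fixes H :: "'a::euclidean_space set"
  assumes H: "subspace H" "0 < dim H" "dim H < DIM('a)" and st: "s \<noteq> 0" "t \<noteq> 0"
    and \<epsilon>: "\<epsilon> > 0"
  obtains G where "subspace G" "dim G = dim H"
    "\<And>x. norm (orthogonal_projection G x - orthogonal_projection H x) \<le> \<epsilon> * norm x"
    "s \<bullet> orthogonal_projection G t \<noteq> 0"
proof -
  let ?p = "orthogonal_projection H"
  let ?C = "orthogonal_comp H"
  have C: "subspace ?C"
    by (rule subspace_orthogonal_comp)
  have "H \<noteq> {0}"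
    using H(2) by auto
  moreover have "?C \<noteq> {0}"
  proof
    assume "?C = {0}"
    then have "x = ?p x" for x
      using orthogonal_projection_works[OF H(1), of x] by simp
    then have "H = UNIV"
      using orthogonal_projection_in[OF H(1)] by (metis UNIV_eq_I)
    then show False
      using H(3) by simp
  qed
  moreover have C_diff: "x - ?p x \<in> ?C" for x
    using orthogonal_projection_works[OF H(1)] by blast
  ultimately obtain e w where e: "e \<in> H" "norm e = 1" "?p s \<noteq> 0 \<Longrightarrow> ?p s \<bullet> e \<noteq> 0"
      "?p t \<noteq> 0 \<Longrightarrow> ?p t \<bullet> e \<noteq> 0"
    and w: "w \<in> ?C" "norm w = 1" "s - ?p s \<noteq> 0 \<Longrightarrow> (s - ?p s) \<bullet> w \<noteq> 0"
      "t - ?p t \<noteq> 0 \<Longrightarrow> (t - ?p t) \<bullet> w \<noteq> 0"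
    using subspace_unit_vector_avoiding[OF H(1) _ orthogonal_projection_in[OF H(1)]
        orthogonal_projection_in[OF H(1)], of s t]
      subspace_unit_vector_avoiding[OF C _ C_diff C_diff, of s t]
    by metis
  have Hw: "z \<bullet> w = 0" if "z \<in> H" for z
    using w(1) that by (auto simp: orthogonal_comp_def orthogonal_def)
  have pw: "(x - ?p x) \<bullet> w = x \<bullet> w" and pe: "?p x \<bullet> e = x \<bullet> e" for x
    using Hw[OF orthogonal_projection_in[OF H(1)]] inner_orthogonal_projection[OF H(1) e(1), of x]
    by (simp_all add: inner_diff_left inner_diff_right inner_commute)
  \<comment> \<open>A nonzero vector has a nonzero component in \<open>H\<close> or in its
    complement, and \<open>e\<close> and \<open>w\<close> were chosen to detect these
    components.\<close>
  have s: "s \<bullet> e \<noteq> 0 \<or> s \<bullet> w \<noteq> 0" and t: "t \<bullet> e \<noteq> 0 \<or> t \<bullet> w \<noteq> 0"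
    using st e(3,4) w(3,4) unfolding pw pe by fastforce+
  \<comment> \<open>The contribution to \<open>s \<bullet> ?p t\<close> of the complement of
    \<open>e\<close> in \<open>H\<close>, which the rotation leaves alone.\<close>
  define K where "K = s \<bullet> ?p t - (s \<bullet> e) * (t \<bullet> e)"
  \<comment> \<open>\<tau> is the tangent of the rotation angle, and the factor
    \<open>1 + \<tau>\<^sup>2\<close> clears the denominators from normalizing \<open>e'\<close>.
    The bound \<open>\<epsilon> / 4\<close> yields
    \<open>norm (e' - e) \<le> \<epsilon> / 2\<close>; the projection then moves by at most twice
    that.\<close>
  obtain \<tau> where \<tau>: "\<bar>\<tau>\<bar> \<le> \<epsilon> / 4"
    and ne: "K * (1 + \<tau>\<^sup>2) + (s \<bullet> e + \<tau> * (s \<bullet> w)) * (t \<bullet> e + \<tau> * (t \<bullet> w)) \<noteq> 0"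
    using quadratic_avoid[OF s t, of "\<epsilon> / 4" K] \<epsilon> by auto
  define r where "r = sqrt (1 + \<tau>\<^sup>2)"
  have r: "r \<ge> 1" "r\<^sup>2 = 1 + \<tau>\<^sup>2" "r \<le> 1 + \<bar>\<tau>\<bar>"
  proof -
    show "r \<ge> 1" "r\<^sup>2 = 1 + \<tau>\<^sup>2"
      by (simp_all add: r_def)
    show "r \<le> 1 + \<bar>\<tau>\<bar>"
      unfolding r_def by (rule real_le_lsqrt) (auto simp: power2_eq_square algebra_simps)
  qed
  define e' where "e' = (e + \<tau> *\<^sub>R w) /\<^sub>R r"
  have ew: "e \<bullet> w = 0"
    using Hw e by blast
  have "(norm (e + \<tau> *\<^sub>R w))\<^sup>2 = r\<^sup>2"
    using ew e(2) w(2) unfolding r(2) power2_norm_eq_inner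
    by (simp add: algebra_simps inner_commute norm_eq_1 power2_eq_square)
  then have "norm (e + \<tau> *\<^sub>R w) = r"
    using r(1) by simp
  then have e': "norm e' = 1"
    using r(1) by (simp add: e'_def)
  have "z \<bullet> e' = 0" if "z \<in> H" "z \<bullet> e = 0" for z
    using that Hw by (simp add: e'_def inner_add_right)
  then obtain G where G: "subspace G" "dim G = dim H"
    "\<And>x. orthogonal_projection G x = ?p x - (x \<bullet> e) *\<^sub>R e + (x \<bullet> e') *\<^sub>R e'"
    using rotated_subspace[OF H(1) e(1,2) e'] by metis
  have "r *\<^sub>R (e' - e) = \<tau> *\<^sub>R w - (r - 1) *\<^sub>R e"
    using r(1) by (simp add: e'_def algebra_simps)
  then have "r * norm (e' - e) = norm (\<tau> *\<^sub>R w - (r - 1) *\<^sub>R e)"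
    using r(1) by (metis norm_scaleR abs_of_nonneg order_trans zero_le_one)
  also have "\<dots> \<le> \<bar>\<tau>\<bar> + (r - 1)"
    using norm_triangle_ineq4[of "\<tau> *\<^sub>R w" "(r - 1) *\<^sub>R e"] e(2) w(2) r(1) by simp
  also have "\<dots> \<le> \<epsilon> / 2"
    using r(3) \<tau> by simp
  finally have dist: "norm (e' - e) \<le> \<epsilon> / 2"
    using mult_right_mono[OF r(1), of "norm (e' - e)"] by simp
  show ?thesis
  proof (rule that[OF G(1,2)])
    fix x
    have "orthogonal_projection G x - ?p x = (x \<bullet> (e' - e)) *\<^sub>R e' + (x \<bullet> e) *\<^sub>R (e' - e)"
      unfolding G(3) by (simp add: algebra_simps)
    then have "norm (orthogonal_projection G x - ?p x) \<le>
        norm ((x \<bullet> (e' - e)) *\<^sub>R e') + norm ((x \<bullet> e) *\<^sub>R (e' - e))"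
      by (simp only: norm_triangle_ineq)
    also have "\<dots> = \<bar>x \<bullet> (e' - e)\<bar> + \<bar>x \<bullet> e\<bar> * norm (e' - e)"
      using e' by simp
    also have "\<dots> \<le> norm x * norm (e' - e) + norm x * norm e * norm (e' - e)"
      by (intro add_mono mult_right_mono Cauchy_Schwarz_ineq2) auto
    also have "\<dots> \<le> \<epsilon> * norm x"
      using mult_left_mono[OF dist, of "norm x"] e(2) by (simp add: algebra_simps)
    finally show "norm (orthogonal_projection G x - ?p x) \<le> \<epsilon> * norm x" .
  next
    have "r * (s \<bullet> e') = s \<bullet> e + \<tau> * (s \<bullet> w)" "r * (t \<bullet> e') = t \<bullet> e + \<tau> * (t \<bullet> w)"
      using r(1) by (simp_all add: e'_def inner_add_right)
    moreover have "s \<bullet> orthogonal_projection G t = K + (s \<bullet> e') * (t \<bullet> e')"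
      by (simp add: G(3) K_def inner_add_right inner_diff_right)
    then have "r\<^sup>2 * (s \<bullet> orthogonal_projection G t) = K * r\<^sup>2 + (r * (s \<bullet> e')) * (r * (t \<bullet> e'))"
      by (simp add: algebra_simps power2_eq_square)
    ultimately show "s \<bullet> orthogonal_projection G t \<noteq> 0"
      using ne r(2) by auto
  qed
qed

text \<open>Each pair is handled by one perturbation, taken so small that the finitely many
  inequalities already achieved survive.\<close>

lemma generic_subspace_near:
  fixes H :: "'a::euclidean_space set" and Z :: "('a \<times> 'a) set"
  assumes "finite Z" "\<And>s t. (s, t) \<in> Z \<Longrightarrow> s \<noteq> 0 \<and> t \<noteq> 0"
    and H: "subspace H" "0 < dim H" "dim H < DIM('a)" and "\<epsilon> > 0"
  shows "\<exists>G. subspace G \<and> dim G = dim H \<and>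
    (\<forall>x. norm (orthogonal_projection G x - orthogonal_projection H x) \<le> \<epsilon> * norm x) \<and>
    (\<forall>(s, t)\<in>Z. s \<bullet> orthogonal_projection G t \<noteq> 0)"
  using assms(1,2,6)
proof (induction Z arbitrary: \<epsilon> rule: finite_induct)
  case empty
  then show ?case
    using H by (intro exI[of _ H]) auto
next
  case (insert z Z)
  have "\<exists>G. subspace G \<and> dim G = dim H \<and>
    (\<forall>x. norm (orthogonal_projection G x - orthogonal_projection H x) \<le> \<epsilon> / 2 * norm x) \<and>
    (\<forall>(s, t)\<in>Z. s \<bullet> orthogonal_projection G t \<noteq> 0)"
    by (rule insert.IH) (use insert.prems in auto)
  then obtain G where G: "subspace G" "dim G = dim H"
    "\<And>x. norm (orthogonal_projection G x - orthogonal_projection H x) \<le> \<epsilon> / 2 * norm x"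
    "\<And>s t. (s, t) \<in> Z \<Longrightarrow> s \<bullet> orthogonal_projection G t \<noteq> 0"
    by fast
  \<comment> \<open>The relative size of \<open>s \<bullet> orthogonal_projection G t\<close>:
    moving the projection by less than this in operator norm keeps the product nonzero.\<close>
  define m where "m = (\<lambda>(s, t). \<bar>s \<bullet> orthogonal_projection G t\<bar> / (norm s * norm t))"
  \<comment> \<open>Including \<epsilon> makes the set nonempty and leaves \<delta> within the
    second half of the error budget; halving makes the comparison with \<open>m\<close>
    strict.\<close>
  define \<delta> where "\<delta> = Min (insert \<epsilon> (m ` Z)) / 2"
  have m: "m z > 0" if "z \<in> Z" for z
    using that G(4) insert.prems(1) by (force simp: m_def split: prod.splits)
  have \<delta>: "\<delta> > 0" "\<delta> \<le> \<epsilon> / 2" "\<And>z. z \<in> Z \<Longrightarrow> \<delta> < m z"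
  proof -
    show pos: "\<delta> > 0"
      using m insert.prems(2) insert.hyps(1) by (simp add: \<delta>_def)
    show "\<delta> \<le> \<epsilon> / 2"
      using insert.hyps(1) by (simp add: \<delta>_def)
    fix z assume "z \<in> Z"
    then have "2 * \<delta> \<le> m z"
      using insert.hyps(1) by (simp add: \<delta>_def)
    then show "\<delta> < m z"
      using pos by simp
  qed
  obtain s0 t0 where z: "z = (s0, t0)"
    by fastforce
  obtain G' where G': "subspace G'" "dim G' = dim G"
    "\<And>x. norm (orthogonal_projection G' x - orthogonal_projection G x) \<le> \<delta> * norm x"
    "s0 \<bullet> orthogonal_projection G' t0 \<noteq> 0"
    using perturb_subspace_avoiding[of G s0 t0 \<delta>] G(1,2) H \<delta>(1) insert.prems(1) z
    by (metis insertI1)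
  have "norm (orthogonal_projection G' x - orthogonal_projection H x) \<le> \<epsilon> * norm x" for x
  proof -
    have "norm (orthogonal_projection G' x - orthogonal_projection H x) \<le>
      norm (orthogonal_projection G' x - orthogonal_projection G x) +
      norm (orthogonal_projection G x - orthogonal_projection H x)"
      using norm_triangle_ineq[of "orthogonal_projection G' x - orthogonal_projection G x"
          "orthogonal_projection G x - orthogonal_projection H x"] by simp
    moreover have "\<delta> * norm x \<le> \<epsilon> / 2 * norm x"
      using \<delta>(2) by (rule mult_right_mono) simp
    ultimately show ?thesis
      using G(3)[of x] G'(3)[of x] by linarith
  qed
  moreover have "s \<bullet> orthogonal_projection G' t \<noteq> 0" if "(s, t) \<in> insert z Z" for s t
  proof (cases "(s, t) = z")
    case True
    then show ?thesis
      using G'(4) z by simp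
  next
    case False
    then have st: "(s, t) \<in> Z"
      using that by simp
    then have "0 < norm s * norm t"
      using insert.prems(1)[of s t] by simp
    then have "\<delta> * (norm s * norm t) < \<bar>s \<bullet> orthogonal_projection G t\<bar>"
      using \<delta>(3)[OF st] by (simp add: m_def pos_less_divide_eq)
    moreover have "\<bar>s \<bullet> (orthogonal_projection G' t - orthogonal_projection G t)\<bar> \<le> norm s * (\<delta> * norm t)"
      using Cauchy_Schwarz_ineq2 G'(3)[of t] by (meson mult_left_mono norm_ge_zero order_trans)
    ultimately show ?thesis
      by (auto simp: inner_diff_right algebra_simps)
  qed
  ultimately show ?case
    using G' G(2) by (intro exI[of _ G']) auto
qed

section \<open>Congruent generic projections\<close>

text \<open>Makes the sign independent of the pair. Relative to a base point \<open>z\<close>, let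
  \<open>x\<close> violate the plus relation and \<open>y\<close> the minus relation; either sign
  for the pair \<open>x\<close>, \<open>y\<close> then forces \<open>a x = a z\<close> or
  \<open>a y = a z\<close>.\<close>

lemma differences_agree_up_to_sign:
  fixes a b :: "'i \<Rightarrow> 'a::real_vector"
  assumes pm: "\<And>x y. x \<in> E \<Longrightarrow> y \<in> E \<Longrightarrow> b x - b y = a x - a y \<or> b x - b y = a y - a x"
  shows "\<exists>c. (\<forall>x\<in>E. b x = c + a x) \<or> (\<forall>x\<in>E. b x = c - a x)"
proof (cases "E = {}")
  case False
  then obtain z where z: "z \<in> E"
    by blast
  show ?thesis
  proof (rule ccontr)
    assume no: "\<not> ?thesis"
    then obtain x where x: "x \<in> E" "b x \<noteq> (b z - a z) + a x"
      by blast
    obtain y where y: "y \<in> E" "b y \<noteq> (b z + a z) - a y"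
      using no by blast
    have bx: "b x = b z + a z - a x" and by': "b y = b z - a z + a y"
      using pm[OF x(1) z] pm[OF y(1) z] x(2) y(2) by (auto simp: algebra_simps)
    have neq: "a x \<noteq> a z" "a y \<noteq> a z"
      using x(2) y(2) bx by' by auto
    have "2 *\<^sub>R a x = 2 *\<^sub>R a z \<or> 2 *\<^sub>R a y = 2 *\<^sub>R a z"
      using pm[OF x(1) y(1)] unfolding bx by' scaleR_2 by (auto simp: algebra_simps)
    then show False
      using neq by simp
  qed
qed simp

text \<open>By \<open>inner_orthogonal_projection_self\<close>, \<open>generic\<close> says that
  differences in \<open>V\<close> and in \<open>W\<close> have projections of equal length only if
  they agree up to sign. This removes the unknown orthogonal map \<phi> from the conclusion.\<close>

lemma generic_congruent_projections:
  fixes V W :: "'a::euclidean_space set"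
  defines "P \<equiv> convex hull V" and "Q \<equiv> convex hull W"
  assumes H: "subspace H" and fin: "finite V" "finite W"
    and generic: "\<And>v v' w w'. \<lbrakk>v \<in> V; v' \<in> V; w \<in> W; w' \<in> W;
        (v - v') + (w - w') \<noteq> 0; (v - v') - (w - w') \<noteq> 0\<rbrakk> \<Longrightarrow>
      ((v - v') + (w - w')) \<bullet> orthogonal_projection H ((v - v') - (w - w')) \<noteq> 0"
    and cong: "congruent_in H (orthogonal_projection H ` P) (orthogonal_projection H ` Q)"
  shows "\<exists>c. orthogonal_projection H ` Q = (+) c ` (orthogonal_projection H ` P) \<or>
    orthogonal_projection H ` Q = (+) c ` (uminus ` (orthogonal_projection H ` P))"
proof -
  let ?p = "orthogonal_projection H"
  note lp = linear_orthogonal_projection[OF H] and pin = orthogonal_projection_in[OF H]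
  obtain \<phi> t where \<phi>: "orthogonal_transformation_on H \<phi>" and t: "\<phi> ` (?p ` P) = (+) t ` (?p ` Q)"
    using cong by (auto simp: congruent_in_def)
  have \<phi>_in: "\<phi> x \<in> H" if "x \<in> H" for x
    using \<phi> that by (auto simp: orthogonal_transformation_on_def)
  have \<phi>_add: "\<phi> (x + y) = \<phi> x + \<phi> y" and \<phi>_inner: "\<phi> x \<bullet> \<phi> y = x \<bullet> y"
    if "x \<in> H" "y \<in> H" for x y
    using \<phi> that by (auto simp: orthogonal_transformation_on_def)
  have \<phi>_scale: "\<phi> (c *\<^sub>R x) = c *\<^sub>R \<phi> x" if "x \<in> H" for c x
    using \<phi> that by (auto simp: orthogonal_transformation_on_def)
  \<comment> \<open>Extends \<phi> by the identity on the orthogonal complement of \<open>H\<close>,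
    giving an injective linear map of the whole space, to which the facts on faces and convex hulls
    apply.\<close>
  define \<Phi> where "\<Phi> x = \<phi> (?p x) + (x - ?p x)" for x
  have \<Phi>_H: "\<Phi> x = \<phi> x" if "x \<in> H" for x
    using that H by (simp add: \<Phi>_def orthogonal_projection_ident)
  have \<Phi>: "linear \<Phi>"
    by (rule linearI)
      (simp_all add: \<Phi>_def linear_add[OF lp] linear_scale[OF lp] \<phi>_add \<phi>_scale pin algebra_simps)
  have "x = 0" if "\<Phi> x = 0" for x
  proof -
    \<comment> \<open>Pairing with \<open>\<phi> (?p x)\<close> discards the component orthogonal to
      \<open>H\<close>.\<close>
    have "0 = \<Phi> x \<bullet> \<phi> (?p x)"
      using that by simp
    also have "\<dots> = ?p x \<bullet> ?p x"
      using orthogonal_projection_residual[OF H \<phi>_in[OF pin], of x x]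
      by (simp add: \<Phi>_def inner_add_left \<phi>_inner pin)
    finally have "?p x = 0"
      by simp
    moreover have "\<phi> 0 = 0"
      using \<phi>_scale[of 0 0] H by (simp add: subspace_0)
    ultimately show "x = 0"
      using that by (simp add: \<Phi>_def)
  qed
  then have inj: "inj \<Phi>"
    using \<Phi> linear_injective_0 by blast
  \<comment> \<open>Undoes the translation by \<open>t\<close>, so that \<psi> carries
    \<open>?p\<close> P\<open>exactly onto\<close>?p \<open>Q\<close>.\<close>
  define \<psi> where "\<psi> x = - t + \<Phi> x" for x
  have pPH: "?p ` P \<subseteq> H"
    using pin by blast
  have pP: "?p ` P = convex hull (?p ` V)" and pQ: "?p ` Q = convex hull (?p ` W)"
    by (simp_all add: P_def Q_def convex_hull_linear_image[OF lp])
  have "\<Phi> ` (?p ` P) = (+) t ` (?p ` Q)"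
    using t \<Phi>_H pPH by (metis image_cong subsetD)
  moreover have \<psi>_comp: "\<psi> ` S = (+) (- t) ` \<Phi> ` S" for S
    unfolding image_image \<psi>_def ..
  ultimately have \<psi>_img: "\<psi> ` (?p ` P) = ?p ` Q"
    using translation_assoc[of "- t" t "?p ` Q"] \<psi>_comp[of "?p ` P"] by simp
  define E where "E = {e. e extreme_point_of (?p ` P)}"
  have E_hull: "?p ` P = convex hull E"
    unfolding E_def pP using fin by (intro Krein_Milman_Minkowski)
      (auto intro: finite_imp_compact_convex_hull)
  have EV: "E \<subseteq> ?p ` V"
    unfolding E_def pP using extreme_point_of_convex_hull by blast
  have EH: "E \<subseteq> H"
    using EV pin by blast
  have EW: "\<psi> ` E \<subseteq> ?p ` W"
  proof
    fix y assume "y \<in> \<psi> ` E"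
    then obtain e where e: "y = \<psi> e" "e extreme_point_of (?p ` P)"
      by (auto simp: E_def)
    have "{\<Phi> e} face_of \<Phi> ` (?p ` P)"
      using face_of_linear_image[OF \<Phi> inj, of "{e}"] e(2) by (simp add: face_of_singleton)
    then have "(- t + \<Phi> e) extreme_point_of ((+) (- t) ` \<Phi> ` (?p ` P))"
      by (simp only: face_of_singleton extreme_point_of_translation_eq image_insert image_empty)
    then have "y extreme_point_of (?p ` Q)"
      using \<psi>_img e(1) unfolding \<psi>_comp by (simp add: \<psi>_def)
    then show "y \<in> ?p ` W"
      unfolding pQ by (rule extreme_point_of_convex_hull)
  qed
  have "\<forall>e\<in>E. \<exists>v. v \<in> V \<and> ?p v = e" "\<forall>e\<in>E. \<exists>w. w \<in> W \<and> ?p w = \<psi> e"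
    using EV EW by (fastforce simp: image_subset_iff image_iff subset_iff)+
  then obtain \<sigma> \<rho> where \<sigma>: "\<And>e. e \<in> E \<Longrightarrow> \<sigma> e \<in> V \<and> ?p (\<sigma> e) = e"
    and \<rho>: "\<And>e. e \<in> E \<Longrightarrow> \<rho> e \<in> W \<and> ?p (\<rho> e) = \<psi> e"
    by (metis (no_types))
  have pm: "\<rho> x - \<rho> y = \<sigma> x - \<sigma> y \<or> \<rho> x - \<rho> y = \<sigma> y - \<sigma> x" if "x \<in> E" "y \<in> E" for x y
  proof -
    have xy: "x - y \<in> H"
      using that EH H subspace_diff by blast
    \<comment> \<open>Both lifted differences project to vectors of length
      \<open>norm (x - y)\<close>, since \<phi> is an isometry on \<open>H\<close>.\<close>
    have "?p (\<rho> x - \<rho> y) = \<Phi> (x - y)"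
      using that \<rho> by (simp add: linear_diff[OF lp] linear_diff[OF \<Phi>] \<psi>_def)
    then have "norm (?p (\<rho> x - \<rho> y)) = norm (x - y)"
      using xy by (simp add: \<Phi>_H norm_eq_sqrt_inner \<phi>_inner)
    moreover have "?p (\<sigma> x - \<sigma> y) = x - y"
      using that \<sigma> by (simp add: linear_diff[OF lp])
    ultimately have "((\<sigma> x - \<sigma> y) + (\<rho> x - \<rho> y)) \<bullet> ?p ((\<sigma> x - \<sigma> y) - (\<rho> x - \<rho> y)) = 0"
      by (simp add: inner_orthogonal_projection_self[OF H])
    then have "(\<sigma> x - \<sigma> y) + (\<rho> x - \<rho> y) = 0 \<or> (\<sigma> x - \<sigma> y) - (\<rho> x - \<rho> y) = 0"
      using generic[of "\<sigma> x" "\<sigma> y" "\<rho> x" "\<rho> y"] \<sigma> \<rho> that by blast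
    then show ?thesis
      by (auto simp: algebra_simps)
  qed
  have Q_hull: "?p ` Q = convex hull (\<psi> ` E)"
  proof -
    have "?p ` Q = (+) (- t) ` \<Phi> ` (convex hull E)"
      using \<psi>_img E_hull \<psi>_comp by metis
    also have "\<dots> = convex hull ((+) (- t) ` \<Phi> ` E)"
      by (simp only: convex_hull_linear_image[OF \<Phi>] convex_hull_translation)
    finally show ?thesis
      by (simp only: \<psi>_comp)
  qed
  obtain c where "(\<forall>x\<in>E. \<rho> x = c + \<sigma> x) \<or> (\<forall>x\<in>E. \<rho> x = c - \<sigma> x)"
    using differences_agree_up_to_sign[of E \<rho> \<sigma>] pm by blast
  \<comment> \<open>Projecting the relation between the lifts shows that on \<open>E\<close> the map
    \<psi> is a translation or a point reflection.\<close>
  then have "(\<forall>x\<in>E. \<psi> x = ?p c + x) \<or> (\<forall>x\<in>E. \<psi> x = ?p c + - x)"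
    using \<sigma> \<rho> by (metis linear_add[OF lp] linear_diff[OF lp] add_uminus_conv_diff)
  then have "\<psi> ` E = (+) (?p c) ` E \<or> \<psi> ` E = (+) (?p c) ` (uminus ` E)"
    by (auto simp: image_image)
  moreover have "convex hull (uminus ` E) = uminus ` (convex hull E)"
    using convex_hull_linear_image[of uminus E] by (simp add: linear_uminus)
  ultimately show ?thesis
    unfolding Q_hull E_hull by (metis convex_hull_translation)
qed

section \<open>Support functions\<close>

definition support_function :: "'a::real_inner set \<Rightarrow> 'a \<Rightarrow> real"
  where "support_function S u = (SUP x\<in>S. u \<bullet> x)"

lemma support_function_eqI:
  assumes "x \<in> S" "\<And>y. y \<in> S \<Longrightarrow> u \<bullet> y \<le> u \<bullet> x"
  shows "support_function S u = u \<bullet> x"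
  unfolding support_function_def using assms by (intro cSup_eq_maximum) auto

lemma support_function_attained:
  assumes "compact S" "S \<noteq> {}"
  obtains x where "x \<in> S" "support_function S u = u \<bullet> x" "\<And>y. y \<in> S \<Longrightarrow> u \<bullet> y \<le> u \<bullet> x"
proof -
  have "continuous_on S ((\<bullet>) u)"
    by (intro continuous_intros)
  then obtain x where "x \<in> S" "\<And>y. y \<in> S \<Longrightarrow> u \<bullet> y \<le> u \<bullet> x"
    using continuous_attains_sup[OF assms] by blast
  then show ?thesis
    using that support_function_eqI by blast
qed

lemma support_function_ge:
  assumes "compact S" "x \<in> S"
  shows "u \<bullet> x \<le> support_function S u"
proof -
  obtain z where "support_function S u = u \<bullet> z" "\<And>y. y \<in> S \<Longrightarrow> u \<bullet> y \<le> u \<bullet> z"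
    using support_function_attained[OF assms(1)] assms(2) by (metis empty_iff)
  then show ?thesis
    using assms(2) by simp
qed

lemma support_function_scaleR:
  assumes "compact S" "S \<noteq> {}" "t > 0"
  shows "support_function S (t *\<^sub>R u) = t * support_function S u"
proof -
  obtain x where x: "x \<in> S" "support_function S u = u \<bullet> x" "\<And>y. y \<in> S \<Longrightarrow> u \<bullet> y \<le> u \<bullet> x"
    using support_function_attained[OF assms(1,2)] by metis
  then have "support_function S (t *\<^sub>R u) = (t *\<^sub>R u) \<bullet> x"
    using assms(3) by (intro support_function_eqI) auto
  then show ?thesis
    using x(2) by simp
qed

lemma support_function_uminus_image:
  "support_function (uminus ` S) u = support_function S (- u)"
  by (simp add: support_function_def image_image)

lemma support_function_translation:
  assumes "compact S" "S \<noteq> {}"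
  shows "support_function ((+) c ` S) u = u \<bullet> c + support_function S u"
proof -
  obtain x where "x \<in> S" "support_function S u = u \<bullet> x" "\<And>y. y \<in> S \<Longrightarrow> u \<bullet> y \<le> u \<bullet> x"
    using support_function_attained[OF assms] by metis
  moreover from this have "support_function ((+) c ` S) u = u \<bullet> (c + x)"
    by (intro support_function_eqI) (auto simp: inner_add_right)
  ultimately show ?thesis
    by (simp add: inner_add_right)
qed

text \<open>Projections thus become restrictions of one function on the whole space, which makes
  different subspaces comparable.\<close>

lemma support_function_orthogonal_projection:
  assumes "subspace H" "u \<in> H"
  shows "support_function (orthogonal_projection H ` S) u = support_function S u"
  using assms by (simp add: support_function_def image_image inner_orthogonal_projection)

text \<open>Any positive bound for the norm on \<open>S\<close> is a Lipschitz constant.\<close>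

lemma continuous_on_support_function:
  fixes S :: "'a::euclidean_space set"
  assumes "compact S" "S \<noteq> {}"
  shows "continuous_on A (support_function S)"
proof -
  obtain R where R: "\<And>x. x \<in> S \<Longrightarrow> norm x \<le> R" "R > 0"
    using compact_imp_bounded[OF assms(1)] bounded_pos by metis
  have *: "support_function S u - support_function S v \<le> R * dist u v" for u v
  proof -
    obtain x where x: "x \<in> S" "support_function S u = u \<bullet> x"
      using support_function_attained[OF assms] by metis
    have "(u - v) \<bullet> x \<le> norm (u - v) * R"
      using norm_cauchy_schwarz[of "u - v" x] mult_left_mono[OF R(1)[OF x(1)], of "norm (u - v)"]
      by simp
    then show ?thesis
      using support_function_ge[OF assms(1) x(1), of v] x(2)
      by (simp add: inner_diff_left dist_norm mult.commute)
  qed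
  have "R-lipschitz_on A (support_function S)"
  proof (rule lipschitz_onI)
    show "dist (support_function S x) (support_function S y) \<le> R * dist x y" for x y
      using *[of x y] *[of y x] by (simp add: dist_real_def dist_commute abs_le_iff)
  qed (use R in auto)
  then show ?thesis
    by (rule lipschitz_on_continuous_on)
qed

lemma support_function_le_imp_subset:
  fixes A B :: "'a::euclidean_space set"
  assumes "compact A" "compact B" "convex B" "B \<noteq> {}"
    and le: "\<And>u. support_function A u \<le> support_function B u"
  shows "A \<subseteq> B"
proof
  fix z assume z: "z \<in> A"
  show "z \<in> B"
  proof (rule ccontr)
    assume "z \<notin> B"
    \<comment> \<open>The hyperplane has \<open>z\<close> on its lower side, so the direction that
      contradicts \<open>le\<close> is \<open>- a\<close>.\<close>
    then obtain a b where ab: "a \<bullet> z < b" "\<forall>x\<in>B. a \<bullet> x > b"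
      using separating_hyperplane_closed_point[of B z] assms compact_imp_closed by blast
    obtain x where x: "x \<in> B" "support_function B (- a) = - a \<bullet> x"
      using support_function_attained[OF assms(2,4)] by metis
    have "- a \<bullet> z \<le> - a \<bullet> x"
      using support_function_ge[OF assms(1) z, of "- a"] le[of "- a"] x(2) by simp
    then show False
      using ab x(1) by fastforce
  qed
qed

section \<open>Functions that are additive on subspaces\<close>

text \<open>Additivity across the cones over \<open>A\<close> and \<open>B\<close> makes the
  increment \<open>g (x + e) - g x\<close> depend on \<open>e\<close> alone. Open cones have room
  for every \<open>e\<close>, so this increment defines \<open>L\<close> everywhere.\<close>

lemma additive_on_open_sets_imp_linear:
  fixes g :: "'a::real_normed_vector \<Rightarrow> real"
  assumes A: "open A" "A \<noteq> {}" and B: "open B" "B \<noteq> {}"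
    and hom: "\<And>t x. t > 0 \<Longrightarrow> g (t *\<^sub>R x) = t * g x"
    and add: "\<And>s t x y. \<lbrakk>x \<in> A; y \<in> B; s > 0; t > 0\<rbrakk> \<Longrightarrow>
      g (s *\<^sub>R x + t *\<^sub>R y) = g (s *\<^sub>R x) + g (t *\<^sub>R y)"
  obtains L where "linear L" "\<And>x. x \<in> A \<union> B \<Longrightarrow> g x = L x"
proof -
  define C where "C S = {t *\<^sub>R x |t x. t > 0 \<and> x \<in> S}" for S :: "'a set"
  have C_scale: "t *\<^sub>R x \<in> C S" if "x \<in> C S" "t > 0" for t x S
    using that unfolding C_def by (smt (verit) mem_Collect_eq mult_pos_pos scaleR_scaleR)
  have C_supset: "x \<in> C S" if "x \<in> S" for x S
    using that unfolding C_def by (metis (mono_tags, lifting) mem_Collect_eq scaleR_one zero_less_one)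
  have C_add: "g (x + y) = g x + g y" if "x \<in> C A" "y \<in> C B" for x y
    using that add by (auto simp: C_def)
  \<comment> \<open>Scaling a ball in \<open>S\<close> puts balls of any radius into the
    cone.\<close>
  have room: "\<exists>x. x \<in> C S \<and> x + e \<in> C S \<and> x + e + e' \<in> C S" if S: "open S" "S \<noteq> {}" for S e e'
  proof -
    obtain a r where r: "r > 0" "ball a r \<subseteq> S"
      using S by (meson ex_in_conv open_contains_ball)
    define s where "s = (norm e + norm e' + 1) / r"
    have s: "s > 0"
      using r(1) by (simp add: s_def add_nonneg_pos)
    have in_C: "s *\<^sub>R a + d \<in> C S" if "norm d \<le> norm e + norm e'" for d
    proof -
      have "norm d < s * r"
        using that r(1) by (simp add: s_def)
      then have "norm (d /\<^sub>R s) < r"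
        using s by (simp add: field_simps)
      then have "a + d /\<^sub>R s \<in> S"
        using r(2) by (auto simp: dist_norm subset_iff)
      then have "s *\<^sub>R (a + d /\<^sub>R s) \<in> C S"
        using C_scale C_supset s by blast
      then show ?thesis
        using s by (simp add: scaleR_add_right)
    qed
    show ?thesis
      using in_C[of 0] in_C[of e] in_C[of "e + e'"]
      by (intro exI[of _ "s *\<^sub>R a"]) (auto simp: norm_triangle_ineq add.assoc)
  qed
  \<comment> \<open>Evaluates \<open>g\<close> at \<open>(x + e) + y = x + (y + e)\<close> in two
    ways.\<close>
  have const: "g (x + e) - g x = g (y + e) - g y"
    if "x \<in> C A" "x + e \<in> C A" "y \<in> C B" "y + e \<in> C B" for x y e
    using C_add[of "x + e" y] C_add[of x "y + e"] that by (simp add: algebra_simps)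
  \<comment> \<open>\<open>const\<close> compares only across the two cones, but one point in each
    cone pins down the increments in the other.\<close>
  have "\<exists>l. \<forall>x. (x \<in> C A \<and> x + e \<in> C A \<longrightarrow> g (x + e) - g x = l) \<and>
      (x \<in> C B \<and> x + e \<in> C B \<longrightarrow> g (x + e) - g x = l)" for e
    using room[OF A, of e 0] room[OF B, of e 0] const by metis
  then obtain L where LA: "\<And>x e. x \<in> C A \<Longrightarrow> x + e \<in> C A \<Longrightarrow> L e = g (x + e) - g x"
    and LB: "\<And>x e. x \<in> C B \<Longrightarrow> x + e \<in> C B \<Longrightarrow> L e = g (x + e) - g x"
    by metis
  have L_add: "L (e + e') = L e + L e'" for e e'
  proof -
    obtain x where "x \<in> C A" "x + e \<in> C A" "x + e + e' \<in> C A"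
      using room[OF A] by blast
    then show ?thesis
      using LA[of x "e + e'"] LA[of x e] LA[of "x + e" e'] by (simp add: add.assoc)
  qed
  have L_pos: "L (t *\<^sub>R e) = t * L e" if "t > 0" for t e
  proof -
    obtain x where "x \<in> C A" "x + e \<in> C A"
      using room[OF A] by blast
    then have "L (t *\<^sub>R e) = g (t *\<^sub>R (x + e)) - g (t *\<^sub>R x)" "L e = g (x + e) - g x"
      using LA C_scale that by (metis scaleR_add_right)+
    then show ?thesis
      using hom[OF that] by (simp add: right_diff_distrib)
  qed
  have L_0: "L 0 = 0"
    using L_add[of 0 0] by simp
  have L_scale: "L (t *\<^sub>R e) = t * L e" for t e
  proof -
    have "L (t *\<^sub>R e) + L ((- t) *\<^sub>R e) = 0"
      using L_add[of "t *\<^sub>R e" "(- t) *\<^sub>R e"] L_0 by simp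
    then show ?thesis
      using L_pos[of t e] L_pos[of "- t" e] L_0 by (cases t "0::real" rule: linorder_cases) auto
  qed
  have "g x = L x" if "x \<in> A \<union> B" for x
  proof -
    \<comment> \<open>By homogeneity the increment of \<open>g\<close> from \<open>x\<close> to
      \<open>x + x\<close> is \<open>g x\<close>, while by definition it is
      \<open>L x\<close>.\<close>
    have "g (x + x) = 2 * g x"
      using hom[of 2 x] by (simp add: scaleR_2)
    then show ?thesis
      using that LA[of x x] LB[of x x] C_supset[of x] C_scale[of x _ 2] by (auto simp: scaleR_2)
  qed
  moreover have "linear L"
    using L_add L_scale by (intro linearI) auto
  ultimately show ?thesis
    using that by blast
qed

text \<open>Lets a failure of additivity survive small independent changes of both
  arguments.\<close>

lemma open_nonadditive:
  fixes f :: "'a::real_normed_vector \<Rightarrow> real"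
  assumes "continuous_on UNIV f" "f (a + b) \<noteq> f a + f b"
  obtains r where "r > 0" "\<And>x y. dist x a < r \<Longrightarrow> dist y b < r \<Longrightarrow> f (x + y) \<noteq> f x + f y"
proof -
  have c: "continuous_on UNIV (\<lambda>z. f (h z))" if "continuous_on UNIV h" for h :: "'a \<times> 'a \<Rightarrow> 'a"
    using continuous_on_compose2[OF assms(1) that] by simp
  have "open {z. f (fst z + snd z) \<noteq> f (fst z) + f (snd z)}" (is "open ?S")
    by (intro open_Collect_neq continuous_intros c)
  moreover have "(a, b) \<in> ?S"
    using assms(2) by simp
  ultimately obtain A B where AB: "open A" "open B" "(a, b) \<in> A \<times> B" "A \<times> B \<subseteq> ?S"
    by (rule open_prod_elim)
  obtain r1 r2 where r: "r1 > 0" "ball a r1 \<subseteq> A" "r2 > 0" "ball b r2 \<subseteq> B"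
    using AB by (meson mem_Sigma_iff open_contains_ball)
  show ?thesis
  proof (rule that[of "min r1 r2"])
    fix x y assume "dist x a < min r1 r2" "dist y b < min r1 r2"
    then have "(x, y) \<in> A \<times> B"
      using r by (auto simp: dist_commute subset_iff)
    then show "f (x + y) \<noteq> f x + f y"
      using AB(4) by auto
  qed (use r in simp)
qed

text \<open>If \<open>f\<close> is not additive at \<open>(a, b)\<close>, then \<open>g\<close> is additive on all planes near
  \<open>span {a, b}\<close>, hence equals a linear map \<open>L\<close> on a neighbourhood \<open>N\<close> of \<open>{a, b, a + b}\<close>.
  If \<open>g\<close> differs from \<open>L\<close> on an open set \<open>U\<close>, then \<open>g\<close> is not additive on any plane
  meeting \<open>N\<close> and \<open>U\<close>, so \<open>f\<close> is, which makes \<open>f\<close> linear on \<open>N\<close>.\<close>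

lemma additive_on_planes_dichotomy:
  fixes f g :: "'a::euclidean_space \<Rightarrow> real"
  assumes f: "continuous_on UNIV f" "\<And>t x. t > 0 \<Longrightarrow> f (t *\<^sub>R x) = t * f x"
    and g: "continuous_on UNIV g" "\<And>t x. t > 0 \<Longrightarrow> g (t *\<^sub>R x) = t * g x"
    and planes: "\<And>u v. (\<forall>x\<in>span {u, v}. \<forall>y\<in>span {u, v}. f (x + y) = f x + f y) \<or>
      (\<forall>x\<in>span {u, v}. \<forall>y\<in>span {u, v}. g (x + y) = g x + g y)"
  shows "(\<forall>x y. f (x + y) = f x + f y) \<or> (\<forall>x y. g (x + y) = g x + g y)"
proof (rule ccontr)
  assume no: "\<not> ?thesis"
  then obtain a b where ab: "f (a + b) \<noteq> f a + f b"
    by blast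
  have mem: "u \<in> span {u, v}" "v \<in> span {u, v}"
    "s *\<^sub>R u \<in> span {u, v}" "s *\<^sub>R v \<in> span {u, v}" for s and u v :: 'a
    by (simp_all add: span_base span_scale)
  obtain r where r: "r > 0" "\<And>x y. dist x a < r \<Longrightarrow> dist y b < r \<Longrightarrow> f (x + y) \<noteq> f x + f y"
    using open_nonadditive[OF f(1) ab] by metis
  have g_add: "g (s *\<^sub>R x + t *\<^sub>R y) = g (s *\<^sub>R x) + g (t *\<^sub>R y)"
    if "x \<in> ball a r" "y \<in> ball b r" for s t x y
  proof -
    have "f (x + y) \<noteq> f x + f y"
      using r(2) that by (simp add: dist_commute)
    then show ?thesis
      using planes[of x y] mem[where u = x and v = y] by blast
  qed
  obtain L where L: "linear L" "\<And>x. x \<in> ball a r \<union> ball b r \<Longrightarrow> g x = L x"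
    using additive_on_open_sets_imp_linear[of "ball a r" "ball b r" g] g_add g(2) r(1)
    by (metis ball_eq_empty not_le open_ball)
  define N where "N = interior {x. g x = L x}"
  have "ball a r \<subseteq> N" "ball b r \<subseteq> N"
    unfolding N_def using L(2) by (intro interior_maximal; auto)+
  \<comment> \<open>Sums of points of the two balls form an open set, on which additivity of
    \<open>g\<close> carries \<open>g = L\<close> over to a neighbourhood of
    \<open>a + b\<close>.\<close>
  moreover have "(\<Union>x\<in>ball a r. \<Union>y\<in>ball b r. {x + y}) \<subseteq> N"
    unfolding N_def
  proof (rule interior_maximal)
    show "(\<Union>x\<in>ball a r. \<Union>y\<in>ball b r. {x + y}) \<subseteq> {x. g x = L x}"
      using g_add[of _ _ 1 1] L by (auto simp: linear_add)
  qed (simp add: open_sums)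
  moreover have "a + b \<in> (\<Union>x\<in>ball a r. \<Union>y\<in>ball b r. {x + y})"
    using r(1) by (intro UN_I) auto
  ultimately have N: "a \<in> N" "b \<in> N" "a + b \<in> N" "open N"
    using r(1) centre_in_ball[of a r] centre_in_ball[of b r] unfolding N_def
    by (meson open_interior subsetD)+
  define U where "U = {u. g u \<noteq> L u}"
  have U: "open U" "U \<noteq> {}"
  proof -
    show "open U"
      unfolding U_def using g(1) L(1)
      by (intro open_Collect_neq) (simp_all add: linear_continuous_on linear_conv_bounded_linear)
    show "U \<noteq> {}"
    proof
      assume "U = {}"
      then have "g = L"
        by (auto simp: U_def)
      then show False
        using no linear_add[OF L(1)] by blast
    qed
  qed
  have f_add: "f (s *\<^sub>R x + t *\<^sub>R u) = f (s *\<^sub>R x) + f (t *\<^sub>R u)" if xu: "x \<in> N" "u \<in> U" for s t x u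
  proof -
    obtain \<epsilon> where \<epsilon>: "\<epsilon> > 0" "ball x \<epsilon> \<subseteq> {x. g x = L x}"
      using xu(1) unfolding N_def mem_interior by blast
    \<comment> \<open>Small enough that \<open>x + \<tau> u\<close> stays where
      \<open>g = L\<close>; as \<open>g (\<tau> u)\<close> differs from \<open>L (\<tau> u)\<close>,
      additivity of \<open>g\<close> fails on \<open>span {x, u}\<close>.\<close>
    define \<tau> where "\<tau> = \<epsilon> / (norm u + 1)"
    have \<tau>: "\<tau> > 0"
      using \<epsilon>(1) by (simp add: \<tau>_def add_nonneg_pos)
    have "0 < norm u + 1"
      by (simp add: add_nonneg_pos)
    then have "\<tau> * norm u < \<epsilon>"
      using \<epsilon>(1) by (simp add: \<tau>_def pos_divide_less_eq distrib_left)
    then have "x + \<tau> *\<^sub>R u \<in> ball x \<epsilon>" "x \<in> ball x \<epsilon>"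
      using \<tau> \<epsilon>(1) by (auto simp: dist_norm)
    then have "g (x + \<tau> *\<^sub>R u) = L x + \<tau> * L u" "g x = L x"
      using subsetD[OF \<epsilon>(2), of "x + \<tau> *\<^sub>R u"] subsetD[OF \<epsilon>(2), of x] L(1)
      by (simp_all add: linear_add linear_scale)
    moreover have "g (\<tau> *\<^sub>R u) \<noteq> \<tau> * L u"
      using g(2)[OF \<tau>] \<tau> xu(2) by (simp add: U_def)
    ultimately have "g (x + \<tau> *\<^sub>R u) \<noteq> g x + g (\<tau> *\<^sub>R u)"
      by simp
    then show ?thesis
      using planes[of x u] mem[where u = x and v = u] by blast
  qed
  obtain M where "linear M" "\<And>x. x \<in> N \<union> U \<Longrightarrow> f x = M x"
    using additive_on_open_sets_imp_linear[of N U f] N U f(2) f_add by (metis empty_iff)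
  then show False
    using ab N by (simp add: linear_add)
qed

text \<open>Positive homogeneity takes the place of continuity in making \<open>f\<close> linear;
  \<open>c\<close> is its Riesz vector in the standard basis.\<close>

lemma additive_continuous_imp_inner:
  fixes f :: "'a::euclidean_space \<Rightarrow> real"
  assumes "\<And>x y. f (x + y) = f x + f y" "\<And>t x. t > 0 \<Longrightarrow> f (t *\<^sub>R x) = t * f x"
  obtains c where "\<And>x. f x = x \<bullet> c"
proof -
  obtain L where L: "linear L" "\<And>x. f x = L x"
    using additive_on_open_sets_imp_linear[of UNIV UNIV f] assms by auto
  then have "f x = x \<bullet> (\<Sum>i\<in>Basis. L i *\<^sub>R i)" for x
    using linear_sum[OF L(1), of "\<lambda>i. (x \<bullet> i) *\<^sub>R i" Basis]
    by (simp add: euclidean_representation linear_scale inner_sum_right mult.commute)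
  then show ?thesis
    using that by blast
qed

section \<open>From congruent projections to translates\<close>

text \<open>If both alternatives failed on \<open>H\<close>, projecting the four witnesses onto a
  generic \<open>G\<close> near \<open>H\<close> would move them so little that both fail on
  \<open>G\<close> as well.\<close>

lemma additive_on_subspaces_of_congruent_projections:
  fixes P Q H :: "'a::euclidean_space set"
  assumes PQ: "polytope P" "P \<noteq> {}" "polytope Q" "Q \<noteq> {}"
    and H: "subspace H" "0 < dim H" "dim H < DIM('a)"
    and cong: "\<And>G. subspace G \<Longrightarrow> dim G = dim H \<Longrightarrow>
      congruent_in G (orthogonal_projection G ` P) (orthogonal_projection G ` Q)"
  defines "f \<equiv> \<lambda>u. support_function P u - support_function Q u"
    and "g \<equiv> \<lambda>u. support_function P u - support_function Q (- u)"
  shows "(\<forall>x\<in>H. \<forall>y\<in>H. f (x + y) = f x + f y) \<or> (\<forall>x\<in>H. \<forall>y\<in>H. g (x + y) = g x + g y)"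
proof (rule ccontr)
  assume "\<not> ?thesis"
  then obtain a b c d where abcd: "a \<in> H" "b \<in> H" "c \<in> H" "d \<in> H"
    and fab: "f (a + b) \<noteq> f a + f b" and gcd: "g (c + d) \<noteq> g c + g d"
    by blast
  have cpt: "compact P" "compact Q"
    using PQ polytope_imp_compact by auto
  have cont: "continuous_on UNIV f" "continuous_on UNIV g"
    unfolding f_def g_def
    by (intro continuous_intros continuous_on_support_function
        continuous_on_compose2[OF continuous_on_support_function[of Q UNIV]]; use cpt PQ in auto)+
  obtain r1 where r1: "r1 > 0" "\<And>x y. dist x a < r1 \<Longrightarrow> dist y b < r1 \<Longrightarrow> f (x + y) \<noteq> f x + f y"
    using open_nonadditive[OF cont(1) fab] by metis
  obtain r2 where r2: "r2 > 0" "\<And>x y. dist x c < r2 \<Longrightarrow> dist y d < r2 \<Longrightarrow> g (x + y) \<noteq> g x + g y"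
    using open_nonadditive[OF cont(2) gcd] by metis
  \<comment> \<open>A strict bound for the norms of the four witnesses, so that
    \<open>\<epsilon> * norm x\<close> stays below both radii.\<close>
  define m where "m = norm a + norm b + norm c + norm d + 1"
  define \<epsilon> where "\<epsilon> = min r1 r2 / m"
  have m: "m > 0" "norm a < m" "norm b < m" "norm c < m" "norm d < m"
    unfolding m_def by (smt (verit) norm_ge_zero)+
  have \<epsilon>: "\<epsilon> > 0" "\<epsilon> * m = min r1 r2"
    using r1 r2 m by (simp_all add: \<epsilon>_def)
  obtain V W where V: "finite V" "P = convex hull V" and W: "finite W" "Q = convex hull W"
    using PQ by (auto simp: polytope_def)
  \<comment> \<open>Sums and differences of a difference in \<open>V\<close> and one in
    \<open>W\<close>. Pairs with a zero entry are those agreeing up to sign and are left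
    out.\<close>
  define Z where "Z = {z \<in> (\<lambda>(v, v', w, w'). ((v - v') + (w - w'), (v - v') - (w - w'))) `
    (V \<times> V \<times> W \<times> W). fst z \<noteq> 0 \<and> snd z \<noteq> 0}"
  have "finite Z"
    using V(1) W(1) by (simp add: Z_def)
  then have "\<exists>G. subspace G \<and> dim G = dim H \<and>
    (\<forall>x. norm (orthogonal_projection G x - orthogonal_projection H x) \<le> \<epsilon> * norm x) \<and>
    (\<forall>(s, t)\<in>Z. s \<bullet> orthogonal_projection G t \<noteq> 0)"
    by (rule generic_subspace_near[OF _ _ H \<epsilon>(1)]) (simp add: Z_def)
  then obtain G where G: "subspace G" "dim G = dim H"
    and near: "\<And>x. norm (orthogonal_projection G x - orthogonal_projection H x) \<le> \<epsilon> * norm x"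
    and gen: "\<And>s t. (s, t) \<in> Z \<Longrightarrow> s \<bullet> orthogonal_projection G t \<noteq> 0"
    by fast
  let ?p = "orthogonal_projection G"
  have close: "dist (?p x) x < min r1 r2" if "x \<in> H" "norm x < m" for x
    using near[of x] that \<epsilon> mult_strict_left_mono[OF that(2) \<epsilon>(1)]
    by (simp add: orthogonal_projection_ident[OF H(1)] dist_norm)
  have "f (?p a + ?p b) \<noteq> f (?p a) + f (?p b)" "g (?p c + ?p d) \<noteq> g (?p c) + g (?p d)"
    using r1(2) r2(2) close abcd m by simp_all
  then have non: "\<not> (\<forall>x\<in>G. \<forall>y\<in>G. f (x + y) = f x + f y)" "\<not> (\<forall>x\<in>G. \<forall>y\<in>G. g (x + y) = g x + g y)"
    using orthogonal_projection_in[OF G(1)] by blast+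
  have "((v - v') + (w - w')) \<bullet> ?p ((v - v') - (w - w')) \<noteq> 0"
    if "v \<in> V" "v' \<in> V" "w \<in> W" "w' \<in> W"
      "(v - v') + (w - w') \<noteq> 0" "(v - v') - (w - w') \<noteq> 0" for v v' w w'
    by (rule gen) (use that in \<open>force simp: Z_def\<close>)
  then obtain z where z: "?p ` Q = (+) z ` (?p ` P) \<or> ?p ` Q = (+) z ` (uminus ` (?p ` P))"
    using generic_congruent_projections[OF G(1) V(1) W(1)] cong[OF G] V(2) W(2) by metis
  have "compact (?p ` P)"
    using cpt linear_orthogonal_projection[OF G(1)]
    by (intro compact_continuous_image linear_continuous_on) (simp_all add: linear_conv_bounded_linear)
  then have pcpt: "compact (?p ` P)" "?p ` P \<noteq> {}" "compact (uminus ` ?p ` P)"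
    using PQ by (simp_all add: compact_negations)
  note proj = support_function_orthogonal_projection[OF G(1)]
  from z show False
  proof
    assume eq: "?p ` Q = (+) z ` (?p ` P)"
    have "f u = - (u \<bullet> z)" if "u \<in> G" for u
      using support_function_translation[OF pcpt(1,2), of z u] proj[OF that, of P]
        proj[OF that, of Q] eq by (simp add: f_def)
    then show False
      using non(1) G(1) by (simp add: subspace_add inner_add_left)
  next
    assume eq: "?p ` Q = (+) z ` (uminus ` (?p ` P))"
    have "g u = u \<bullet> z" if "u \<in> G" for u
    proof -
      \<comment> \<open>Evaluating \<open>support_function Q\<close> at \<open>- u\<close> cancels
        the reflection and leaves the support function of \<open>P\<close> at
        \<open>u\<close>.\<close>
      have u: "- u \<in> G"
        using that G(1) by (simp add: subspace_neg)
      show ?thesis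
        using support_function_translation[OF pcpt(3), of z "- u"] pcpt(2) proj[OF that, of P]
          proj[OF u, of Q] eq by (simp add: g_def support_function_uminus_image)
    qed
    then show False
      using non(2) G(1) by (simp add: subspace_add inner_add_left)
  qed
qed

text \<open>A nonempty compact convex set is determined by its support function, and translation
  adds a linear term to it.\<close>

lemma support_function_eq_translation:
  fixes P Q :: "'a::euclidean_space set"
  assumes "compact P" "convex P" "P \<noteq> {}" "compact Q" "convex Q" "Q \<noteq> {}"
    and "\<And>u. support_function P u = u \<bullet> c + support_function Q u"
  shows "P = (+) c ` Q"
proof -
  have "compact ((+) c ` Q)" "convex ((+) c ` Q)" "(+) c ` Q \<noteq> {}"
    using assms by (auto simp: compact_translation convex_translation)
  moreover have "support_function ((+) c ` Q) u = support_function P u" for u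
    using assms support_function_translation by metis
  ultimately show ?thesis
    using assms by (intro subset_antisym support_function_le_imp_subset) auto
qed

lemma subspace_of_dim_containing:
  fixes S :: "'a::euclidean_space set"
  assumes "subspace S" "dim S \<le> k" "k \<le> DIM('a)"
  shows "\<exists>H. subspace H \<and> S \<subseteq> H \<and> dim H = k"
  using assms(2,3)
proof (induction k rule: dec_induct)
  case base
  then show ?case
    using assms(1) by blast
next
  case (step n)
  then obtain H where H: "subspace H" "S \<subseteq> H" "dim H = n"
    by auto
  then have "H \<noteq> UNIV"
    using step.prems by auto
  then obtain w where w: "w \<notin> H"
    by blast
  have "dim (span (insert w H)) = Suc n"
    using w H by (simp add: dim_insert span_eq_iff[THEN iffD2])
  then show ?case
    using H(2) by (intro exI[of _ "span (insert w H)"]) (auto intro: span_base)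
qed

theorem theorem1:
  fixes P Q :: "'a::euclidean_space set" and k :: nat
  assumes "2 \<le> k" and "k \<le> DIM('a) - 1"
    and "convex_polytope P" and "convex_polytope Q"
    and "\<And>H. subspace H \<Longrightarrow> dim H = k \<Longrightarrow>
      congruent_in H (orthogonal_projection H ` P) (orthogonal_projection H ` Q)"
  shows "\<exists>b. P = (+) b ` Q \<or> P = (+) b ` (uminus ` Q)"
proof -
  have P: "polytope P" "P \<noteq> {}" "compact P" "convex P"
    and Q: "polytope Q" "Q \<noteq> {}" "compact Q" "convex Q"
    using assms(3,4) by (auto simp: convex_polytope_def polytope_imp_compact polytope_imp_convex)
  have uQ: "uminus ` Q \<noteq> {}" "compact (uminus ` Q)" "convex (uminus ` Q)"
    using Q by (auto intro: compact_negations convex_negations)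
  define f where "f u = support_function P u - support_function Q u" for u
  define g where "g u = support_function P u - support_function Q (- u)" for u
  have f_hom: "f (t *\<^sub>R x) = t * f x" and g_hom: "g (t *\<^sub>R x) = t * g x" if "t > 0" for t x
    using support_function_scaleR[OF P(3,2) that] support_function_scaleR[OF Q(3,2) that, of x]
      support_function_scaleR[OF Q(3,2) that, of "- x"]
    by (simp_all add: f_def g_def right_diff_distrib)
  have cont: "continuous_on UNIV f" "continuous_on UNIV g"
    unfolding f_def g_def
    by (intro continuous_intros continuous_on_support_function
        continuous_on_compose2[OF continuous_on_support_function[of Q UNIV]]; use P Q in auto)+
  have "(\<forall>x\<in>span {u, v}. \<forall>y\<in>span {u, v}. f (x + y) = f x + f y) \<or>
      (\<forall>x\<in>span {u, v}. \<forall>y\<in>span {u, v}. g (x + y) = g x + g y)" for u v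
  proof -
    \<comment> \<open>This is where \<open>2 \<le> k\<close> enters: every plane lies in some
      \<open>k\<close>-dimensional subspace.\<close>
    have "dim (span {u, v}) \<le> card {u, v}"
      by (simp add: dim_le_card')
    also have "\<dots> \<le> 2"
      by (simp add: card_insert_if)
    finally have "dim (span {u, v}) \<le> k"
      using assms(1) by simp
    then obtain H where H: "span {u, v} \<subseteq> H" "subspace H" "dim H = k"
      using subspace_of_dim_containing[OF subspace_span, of "{u, v}" k] le_trans[OF assms(2) diff_le_self]
      by blast
    \<comment> \<open>As \<open>2 \<le> k\<close>, the natural subtraction in
      \<open>DIM('a) - 1\<close> does not truncate, and the inequality is strict.\<close>
    have k: "0 < k" "k < DIM('a)"
      using assms(1,2) by auto
    show ?thesis
      using additive_on_subspaces_of_congruent_projections[OF P(1,2) Q(1,2) H(2)] H(1,3) k assms(5)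
      unfolding f_def g_def by (meson subsetD)
  qed
  then consider "\<forall>x y. f (x + y) = f x + f y" | "\<forall>x y. g (x + y) = g x + g y"
    using additive_on_planes_dichotomy[OF cont(1) f_hom cont(2) g_hom] by blast
  then show ?thesis
  proof cases
    case 1
    then obtain c where "\<And>u. f u = u \<bullet> c"
      using additive_continuous_imp_inner f_hom by metis
    then have "support_function P u = u \<bullet> c + support_function Q u" for u
      by (simp add: f_def algebra_simps)
    then have "P = (+) c ` Q"
      using P Q by (intro support_function_eq_translation) auto
    then show ?thesis
      by blast
  next
    case 2
    then obtain c where "\<And>u. g u = u \<bullet> c"
      using additive_continuous_imp_inner g_hom by metis
    \<comment> \<open>Reflecting \<open>Q\<close> reduces this case to the previous one.\<close>
    then have "support_function P u = u \<bullet> c + support_function (uminus ` Q) u" for u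
      by (simp add: g_def support_function_uminus_image algebra_simps)
    then have "P = (+) c ` (uminus ` Q)"
      using P uQ by (intro support_function_eq_translation) auto
    then show ?thesis
      by blast
  qed
qed

end
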